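(* Let $n \ge 4$ be an even integer and let $G$ be a finite solvable group whose character degree graph $\Delta(G)$ has exactly $n$ vertices and is $(n-2)$-regular. Let $n_1$ be an integer with $1\le n_1\le \frac n2$, and let $\Delta(G_1)$ be a character degree graph of a finite solvable group $G_1$ which is the supergraph of $\Delta(G)$, on the same $n$ vertices, obtained by adding $n_1$ new edges (each joining a pair of vertices non-adjacent in $\Delta(G)$). Then the characteristic polynomial of the Laplacian matrix of $\Delta(G_1)$ is $$x\,(x-(n-2))^{\frac{n}{2}-n_1}\,(x-n)^{\frac{n}{2}+n_1-1}.$$
   Context: For a finite group $G$, $\mathrm{Irr}(G)$ is the set of complex irreducible characters of $G$, $\mathrm{cd}(G)=\{\chi(1) : \chi\in \mathrm{Irr}(G)\}$, and $\rho(G)$ is the set of primes dividing some element of $\mathrm{cd}(G)$. The character degree graph $\Delta(G)$ is the simple undirected graph with vertex set $\rho(G)$ in which distinct primes $p,q$ are adjacent if and only if $pq$ divides some $r\in \mathrm{cd}(G)$. Graphs are considered up to isomorphism. For a finite simple graph $\Gamma$, the Laplacian matrix is $L(\Gamma)=D(\Gamma)-A(\Gamma)$, where $D(\Gamma)$ is the diagonal matrix of vertex degrees and $A(\Gamma)$ is the adjacency matrix. The characteristic polynomial of an $n\times n$ matrix $M$ is taken to be the monic polynomial $\det(xI-M)$. *)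

theory Defs
  imports
    "HOL-Algebra.Solvable_Groups"
    "HOL-Computational_Algebra.Primes"
    "Jordan_Normal_Form.Char_Poly"
    "Jordan_Normal_Form.VS_Connect"
begin

section \<open>Complex irreducible characters\<close>

abbreviation general_linear :: "nat \<Rightarrow> complex mat monoid" where
  "general_linear d \<equiv> units_of (ring_mat TYPE(complex) d ())"

definition irreducible_representation ::
    "('a, 'm) monoid_scheme \<Rightarrow> nat \<Rightarrow> ('a \<Rightarrow> complex mat) \<Rightarrow> bool" where
  "irreducible_representation G d R \<longleftrightarrow>
     R \<in> hom G (general_linear d) \<and> d > 0 \<and>
     (\<forall>W. VectorSpace.subspace class_ring W (module_vec TYPE(complex) d) \<and>
          (\<forall>g\<in>carrier G. \<forall>w\<in>W. R g *\<^sub>v w \<in> W) \<longrightarrow>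
          W = {0\<^sub>v d} \<or> W = carrier_vec d)"

definition mat_trace :: "'a :: comm_monoid_add mat \<Rightarrow> 'a" where
  "mat_trace A = (\<Sum>i<dim_row A. A $$ (i, i))"

text \<open>Characters are functions on the carrier; outside of it they are \<^const>\<open>undefined\<close>.\<close>

definition Irr :: "('a, 'm) monoid_scheme \<Rightarrow> ('a \<Rightarrow> complex) set" where
  "Irr G = {\<chi>. \<exists>d R. irreducible_representation G d R \<and>
                    \<chi> = restrict (\<lambda>g. mat_trace (R g)) (carrier G)}"

definition cd :: "('a, 'm) monoid_scheme \<Rightarrow> nat set" where
  "cd G = {r. \<exists>\<chi>\<in>Irr G. \<chi> \<one>\<^bsub>G\<^esub> = of_nat r}"

definition degree_primes :: "('a, 'm) monoid_scheme \<Rightarrow> nat set" where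
  "degree_primes G = {p. prime p \<and> (\<exists>r\<in>cd G. p dvd r)}"


section \<open>Simple graphs\<close>

text \<open>A simple undirected graph is a pair of a vertex set and a set of edges, each edge being a
  set of two distinct vertices.\<close>

type_synonym 'v graph = "'v set \<times> 'v set set"

abbreviation verts :: "'v graph \<Rightarrow> 'v set" where "verts \<equiv> fst"
abbreviation edges :: "'v graph \<Rightarrow> 'v set set" where "edges \<equiv> snd"

definition vertex_degree :: "'v graph \<Rightarrow> 'v \<Rightarrow> nat" where
  "vertex_degree \<Gamma> v = card {w \<in> verts \<Gamma>. {v, w} \<in> edges \<Gamma>}"

definition regular_graph :: "nat \<Rightarrow> 'v graph \<Rightarrow> bool" where
  "regular_graph k \<Gamma> \<longleftrightarrow> (\<forall>v\<in>verts \<Gamma>. vertex_degree \<Gamma> v = k)"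

definition non_edges :: "'v graph \<Rightarrow> 'v set set" where
  "non_edges \<Gamma> = {{u, v} | u v. u \<in> verts \<Gamma> \<and> v \<in> verts \<Gamma> \<and> u \<noteq> v \<and> {u, v} \<notin> edges \<Gamma>}"

definition add_edges :: "'v graph \<Rightarrow> 'v set set \<Rightarrow> 'v graph" where
  "add_edges \<Gamma> N = (verts \<Gamma>, edges \<Gamma> \<union> N)"

definition graph_isomorphic :: "'v graph \<Rightarrow> 'w graph \<Rightarrow> bool" where
  "graph_isomorphic \<Gamma> \<Gamma>' \<longleftrightarrow>
     (\<exists>f. bij_betw f (verts \<Gamma>) (verts \<Gamma>') \<and>
          (\<forall>u\<in>verts \<Gamma>. \<forall>v\<in>verts \<Gamma>. {u, v} \<in> edges \<Gamma> \<longleftrightarrow> {f u, f v} \<in> edges \<Gamma>'))"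

definition character_degree_graph :: "('a, 'm) monoid_scheme \<Rightarrow> nat graph" where
  "character_degree_graph G =
     (degree_primes G,
      {{p, q} | p q. p \<in> degree_primes G \<and> q \<in> degree_primes G \<and> p \<noteq> q \<and>
                     (\<exists>r\<in>cd G. p * q dvd r)})"


section \<open>The Laplacian matrix\<close>

text \<open>Rows and columns are indexed by positions in a list \<open>vs\<close> enumerating the vertices
  without repetition.\<close>

definition degree_matrix :: "'v graph \<Rightarrow> 'v list \<Rightarrow> real mat" where
  "degree_matrix \<Gamma> vs = mat (length vs) (length vs)
     (\<lambda>(i, j). if i = j then real (vertex_degree \<Gamma> (vs ! i)) else 0)"

definition adjacency_matrix :: "'v graph \<Rightarrow> 'v list \<Rightarrow> real mat" where
  "adjacency_matrix \<Gamma> vs = mat (length vs) (length vs)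
     (\<lambda>(i, j). if {vs ! i, vs ! j} \<in> edges \<Gamma> then 1 else 0)"

definition laplacian_matrix :: "'v graph \<Rightarrow> 'v list \<Rightarrow> real mat" where
  "laplacian_matrix \<Gamma> vs = degree_matrix \<Gamma> vs - adjacency_matrix \<Gamma> vs"

end

theory Submission
  imports Defs "Jordan_Normal_Form.Schur_Decomposition"
begin

text \<open>The complement of $\Delta(G)$ is a perfect matching, so that of $\Delta(G_1)$ is a matching with
  $m = n/2 - n_1$ edges. Hence every eigenvalue of the Laplacian $L$ is one of $0$, $n - 2$, $n$:
  an eigenvector for a nonzero eigenvalue has coordinate sum $0$, and then the eigenvalue equation
  only links the ends of each matching edge. The three multiplicities follow from their sum $n$ and
  from the traces of $L$ and $L^2$, which depend only on the vertex degrees.\<close>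

section \<open>Traces and eigenvalues\<close>

lemma mat_trace_mult_commute:
  fixes A B :: "'a :: comm_semiring_0 mat"
  assumes "A \<in> carrier_mat n m" and "B \<in> carrier_mat m n"
  shows "mat_trace (A * B) = mat_trace (B * A)"
proof -
  have "mat_trace (A * B) = (\<Sum>i<n. \<Sum>j<m. A $$ (i, j) * B $$ (j, i))"
    using assms by (auto simp: mat_trace_def scalar_prod_def atLeast0LessThan intro!: sum.cong)
  also have "\<dots> = (\<Sum>j<m. \<Sum>i<n. B $$ (j, i) * A $$ (i, j))"
    by (subst sum.swap) (simp add: mult.commute)
  also have "\<dots> = mat_trace (B * A)"
    using assms by (auto simp: mat_trace_def scalar_prod_def atLeast0LessThan intro!: sum.cong)
  finally show ?thesis .
qed

lemma mat_trace_similar: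
  fixes A B :: "'a :: comm_ring_1 mat"
  assumes "similar_mat_wit A B P Q"
  shows "mat_trace A = mat_trace B"
proof -
  note wit = similar_mat_witD[OF refl assms]
  have "mat_trace A = mat_trace (P * (B * Q))"
    using wit by (metis assoc_mult_mat)
  also have "\<dots> = mat_trace (B * Q * P)"
    using wit mat_trace_mult_commute[of P] by (metis mult_carrier_mat)
  also have "B * Q * P = B"
    using wit by (metis assoc_mult_mat right_mult_one_mat)
  finally show ?thesis .
qed

lemma mat_trace_conv_diag_mat: "mat_trace A = sum_list (diag_mat A)"
  by (simp add: mat_trace_def diag_mat_def sum_list_distinct_conv_sum_set atLeast0LessThan)

text \<open>For \<open>j\<close> different from \<open>i\<close>, one of the entries
  \<open>(i, j)\<close> and \<open>(j, i)\<close> lies strictly below the diagonal, so the products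
  off the diagonal vanish.\<close>

lemma mat_trace_square_upper_triangular:
  fixes A :: "'a :: comm_semiring_1 mat"
  assumes A: "A \<in> carrier_mat n n" and ut: "upper_triangular A"
  shows "mat_trace (A * A) = (\<Sum>a\<leftarrow>diag_mat A. a\<^sup>2)"
proof -
  have "(A * A) $$ (i, i) = (A $$ (i, i))\<^sup>2" if i: "i < n" for i
  proof -
    have "(A * A) $$ (i, i) = (\<Sum>j<n. A $$ (i, j) * A $$ (j, i))"
      using i A by (simp add: scalar_prod_def atLeast0LessThan)
    also have "\<dots> = (\<Sum>j<n. if j = i then (A $$ (i, i))\<^sup>2 else 0)"
    proof (rule sum.cong)
      fix j assume "j \<in> {..<n}"
      then show "A $$ (i, j) * A $$ (j, i) = (if j = i then (A $$ (i, i))\<^sup>2 else 0)"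
        using upper_triangularD[OF ut, of j i] upper_triangularD[OF ut, of i j] i A
        by (cases j i rule: linorder_cases) (auto simp: power2_eq_square)
    qed simp
    finally show ?thesis using i by simp
  qed
  then show ?thesis
    using A by (simp add: mat_trace_def diag_mat_def sum_list_distinct_conv_sum_set
        atLeast0LessThan comp_def)
qed

text \<open>Schur decomposition makes \<open>A\<close> similar to a triangular matrix with diagonal
  \<open>es\<close>. Its square is similar to \<open>A * A\<close> through the same pair, and traces
  are invariant under similarity.\<close>

lemma
  fixes A :: "complex mat"
  assumes A: "A \<in> carrier_mat n n" and es: "char_poly A = (\<Prod>e\<leftarrow>es. [:- e, 1:])"
  shows mat_trace_eigenvalues: "mat_trace A = sum_list es"
    and mat_trace_square_eigenvalues: "mat_trace (A * A) = (\<Sum>e\<leftarrow>es. e\<^sup>2)"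
proof -
  obtain B P Q where "schur_decomposition A es = (B, P, Q)"
    by (cases "schur_decomposition A es") auto
  from schur_decomposition[OF A es this] have sim: "similar_mat_wit A B P Q"
    and ut: "upper_triangular B" and diag: "diag_mat B = es"
    by auto
  note wit = similar_mat_witD2[OF A sim]
  show "mat_trace A = sum_list es"
    using mat_trace_similar[OF sim] diag by (simp add: mat_trace_conv_diag_mat)
  have "similar_mat_wit (A ^\<^sub>m 2) (B ^\<^sub>m 2) P Q"
    by (rule similar_mat_wit_pow[OF sim])
  then have "similar_mat_wit (A * A) (B * B) P Q"
    using wit by (simp add: numeral_2_eq_2)
  from mat_trace_similar[OF this] show "mat_trace (A * A) = (\<Sum>e\<leftarrow>es. e\<^sup>2)"
    using mat_trace_square_upper_triangular[OF wit(5) ut] diag by simp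
qed

text \<open>For the list of eigenvalues, taking \<open>f\<close> constantly 1, the identity and the
  square yields three linear equations in the three multiplicities.\<close>

lemma sum_list_three_values:
  fixes f :: "'a \<Rightarrow> 'b :: comm_semiring_1"
  assumes "set xs \<subseteq> {x, y, z}" and "x \<noteq> y" "x \<noteq> z" "y \<noteq> z"
  shows "(\<Sum>a\<leftarrow>xs. f a) = of_nat (count_list xs x) * f x + of_nat (count_list xs y) * f y
    + of_nat (count_list xs z) * f z"
  using assms by (induction xs) (auto simp: algebra_simps)

lemma prod_list_three_values:
  fixes f :: "'a \<Rightarrow> 'b :: comm_monoid_mult"
  assumes "set xs \<subseteq> {x, y, z}" and "x \<noteq> y" "x \<noteq> z" "y \<noteq> z"
  shows "(\<Prod>a\<leftarrow>xs. f a) = f x ^ count_list xs x * f y ^ count_list xs y * f z ^ count_list xs z"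
  using assms by (induction xs) (auto simp: mult_ac)


section \<open>Graphs whose complement is a matching\<close>

text \<open>Here \<open>eq\<close> is the eigenvalue equation read coordinatewise. The hypothesis
  \<open>deg\<close> is written additively to avoid truncated subtraction; it bounds the degrees of
  the complement by 1, so the equation splits into independent systems in one or two
  unknowns.\<close>

lemma near_complete_laplacian_eigenvalue:
  fixes x :: "'i \<Rightarrow> 'a :: field_char_0"
  assumes fin: "finite V" and sym: "\<And>i j. adj i j \<Longrightarrow> adj j i" and irrefl: "\<And>i. i \<in> V \<Longrightarrow> \<not> adj i i"
    and deg: "\<And>i. i \<in> V \<Longrightarrow> card V \<le> card {j \<in> V. adj i j} + 2"
    and eq: "\<And>i. i \<in> V \<Longrightarrow>
      of_nat (card {j \<in> V. adj i j}) * x i - (\<Sum>j\<in>{j \<in> V. adj i j}. x j) = e * x i"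
    and nz: "i\<^sub>0 \<in> V" "x i\<^sub>0 \<noteq> 0"
  shows "e \<in> {0, of_nat (card V) - 2, of_nat (card V)}"
proof (rule ccontr)
  assume "\<not> ?thesis"
  then have e: "e \<noteq> 0" "e \<noteq> of_nat (card V) - 2" "e \<noteq> of_nat (card V)"
    by auto
  \<comment> \<open>The neighbours of \<open>i\<close> in the complement graph.\<close>
  define C where "C i = {j \<in> V. j \<noteq> i \<and> \<not> adj i j}" for i
  have split: "V = insert i ({j \<in> V. adj i j} \<union> C i)" "i \<notin> {j \<in> V. adj i j} \<union> C i"
    "{j \<in> V. adj i j} \<inter> C i = {}" if "i \<in> V" for i
    using that irrefl by (auto simp: C_def)
  have finC: "finite (C i)" for i
    using fin by (simp add: C_def)
  have cardV: "card V = 1 + card {j \<in> V. adj i j} + card (C i)" if "i \<in> V" for i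
    using split(2-3)[OF that] fin finC
    by (subst split(1)[OF that]) (simp add: card_Un_disjoint)
  have sumV: "sum x V = x i + (\<Sum>j\<in>{j \<in> V. adj i j}. x j) + sum x (C i)" if "i \<in> V" for i
    using split(2-3)[OF that] fin finC
    by (subst split(1)[OF that]) (simp add: sum.union_disjoint add.assoc)
  \<comment> \<open>The columns of the Laplacian sum to zero: by symmetry, \<open>x j\<close> is
    counted once for each neighbour of \<open>j\<close>. Summing \<open>eq\<close> over
    \<open>V\<close> therefore leaves \<open>e * sum x V = 0\<close>.\<close>
  have "(\<Sum>i\<in>V. \<Sum>j\<in>{j \<in> V. adj i j}. x j) = (\<Sum>j\<in>V. \<Sum>i\<in>{i \<in> V. adj i j}. x j)"
    using fin by (rule sum.swap_restrict) (rule fin)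
  also have "\<dots> = (\<Sum>j\<in>V. of_nat (card {i \<in> V. adj j i}) * x j)"
    using sym by (auto intro!: sum.cong arg_cong[where f = card])
  finally have "(\<Sum>i\<in>V. of_nat (card {j \<in> V. adj i j}) * x i - (\<Sum>j\<in>{j \<in> V. adj i j}. x j)) = 0"
    by (simp add: sum_subtractf)
  then have "(\<Sum>i\<in>V. e * x i) = 0"
    using eq by (simp cong: sum.cong)
  then have "e * sum x V = 0"
    by (simp only: sum_distrib_left)
  with e have "sum x V = 0"
    by simp
  with sumV have nbrs: "(\<Sum>j\<in>{j \<in> V. adj i j}. x j) = - x i - sum x (C i)" if "i \<in> V" for i
    using sumV[OF that] \<open>sum x V = 0\<close>
    by (simp add: eq_diff_eq eq_neg_iff_add_eq_0 ac_simps)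
  \<comment> \<open>On vectors with coordinate sum 0, the Laplacian is \<open>card V\<close> times
    the identity minus the Laplacian of the complement, so only the small sets \<open>C i\<close>
    remain.\<close>
  have eqC: "(of_nat (card V) - of_nat (card (C i))) * x i + sum x (C i) = e * x i" if "i \<in> V" for i
    using eq[OF that] cardV[OF that] nbrs[OF that] by (simp add: algebra_simps)
  have "card (C i\<^sub>0) \<le> 1"
    using cardV[OF nz(1)] deg[OF nz(1)] by linarith
  then consider "C i\<^sub>0 = {}" | j where "C i\<^sub>0 = {j}"
    using finC[of i\<^sub>0] by (metis card_0_eq card_1_singletonE le_less less_one)
  then show False
  proof cases
    case 1
    then show False using eqC[OF nz(1)] nz e by simp
  next
    case (2 j)
    then have j: "j \<in> V" and "i\<^sub>0 \<in> C j"
      using nz(1) sym by (auto simp: C_def)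
    moreover have "card (C j) \<le> 1"
      using cardV[OF j] deg[OF j] by linarith
    \<comment> \<open>Non-adjacency is symmetric, so \<open>i\<^sub>0\<close> and \<open>j\<close>
      form an isolated edge of the complement and their two equations are closed.\<close>
    ultimately have Cj: "C j = {i\<^sub>0}"
      using finC[of j] by (auto simp: card_le_Suc0_iff_eq)
    have eq1: "(of_nat (card V) - 1) * x i\<^sub>0 + x j = e * x i\<^sub>0"
      using eqC[OF nz(1)] 2 by simp
    have eq2: "(of_nat (card V) - 1) * x j + x i\<^sub>0 = e * x j"
      using eqC[OF j] Cj by simp
    \<comment> \<open>Adding \<open>eq1\<close> and \<open>eq2\<close> shows that
      \<open>x i\<^sub>0 + x j\<close> is scaled by both \<open>card V\<close> and \<open>e\<close>,
      hence is 0. Then \<open>eq1\<close> forces the excluded value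
      \<open>card V - 2\<close>.\<close>
    have "(of_nat (card V) - e) * (x i\<^sub>0 + x j)
      = ((of_nat (card V) - 1) * x i\<^sub>0 + x j - e * x i\<^sub>0)
        + ((of_nat (card V) - 1) * x j + x i\<^sub>0 - e * x j)"
      by (simp add: algebra_simps)
    then have "(of_nat (card V) - e) * (x i\<^sub>0 + x j) = 0"
      by (simp only: eq1 eq2 diff_self add_0)
    then have "x j = - x i\<^sub>0"
      using e by (simp add: eq_neg_iff_add_eq_0 add.commute)
    then have "(of_nat (card V) - 2 - e) * x i\<^sub>0 = 0"
      using eq1 by (simp add: algebra_simps)
    then show False
      using e nz by simp
  qed
qed

text \<open>The right-hand sides are the sums of \<open>d\<close> and of \<open>d^2 + d\<close> over
  the degrees \<open>d\<close>: there are \<open>2 * m\<close> vertices of degree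
  \<open>n - 2\<close>, and the others have degree \<open>n - 1\<close>. The system is linear in
  \<open>a\<close>, \<open>b\<close>, \<open>c\<close>.\<close>

lemma near_complete_multiplicities:
  fixes a b c m n :: nat
  assumes "n > 2" and "a + b + c = n"
    and tr: "(real n - 2) * real b + real n * real c
      = 2 * real m * (real n - 2) + (real n - 2 * real m) * (real n - 1)"
    and tr2: "(real n - 2)\<^sup>2 * real b + (real n)\<^sup>2 * real c
      = 2 * real m * ((real n - 2)\<^sup>2 + (real n - 2))
        + (real n - 2 * real m) * ((real n - 1)\<^sup>2 + (real n - 1))"
  shows "a = 1" "b = m" "c = n - 1 - m"
proof -
  \<comment> \<open>Subtracting \<open>tr2\<close> from \<open>n\<close> times \<open>tr\<close>
    eliminates \<open>c\<close>. The coefficient left for \<open>b\<close> is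
    \<open>2 * (n - 2)\<close>, nonzero since \<open>n > 2\<close>.\<close>
  have "2 * (real n - 2) * (real b - real m)
    = real n * ((real n - 2) * real b + real n * real c)
      - ((real n - 2)\<^sup>2 * real b + (real n)\<^sup>2 * real c)
      - 2 * real m * (real n - 2)"
    by (simp add: algebra_simps power2_eq_square)
  also have "\<dots> = 0"
    unfolding tr tr2 by (simp add: algebra_simps power2_eq_square)
  finally have "2 * (real n - 2) * (real b - real m) = 0" .
  then show b: "b = m"
    using \<open>n > 2\<close> by simp
  have "real n * (real c + real m + 1 - real n) = 0"
    using tr b by (simp add: algebra_simps)
  then have "real (c + m + 1) = real n"
    using \<open>n > 2\<close> by simp
  then have "c + m + 1 = n"
    by (simp only: of_nat_eq_iff)
  then show "c = n - 1 - m" "a = 1"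
    using assms(2) b by auto
qed

text \<open>The matching enters through degrees alone: a vertex of degree \<open>n - 2\<close> is an
  end of exactly one complement edge, and every other vertex has degree \<open>n - 1\<close>. Thus
  \<open>m\<close> counts the edges of the complement.\<close>

lemma char_poly_laplacian_near_complete:
  fixes \<Gamma> :: "'v graph"
  assumes vs: "distinct vs" "set vs = verts \<Gamma>" and n: "card (verts \<Gamma>) = n" "n > 2"
    and loopless: "\<And>v. v \<in> verts \<Gamma> \<Longrightarrow> {v} \<notin> edges \<Gamma>"
    and deg: "\<And>v. v \<in> verts \<Gamma> \<Longrightarrow> n - 2 \<le> vertex_degree \<Gamma> v"
    and m: "card {v \<in> verts \<Gamma>. vertex_degree \<Gamma> v = n - 2} = 2 * m"
  shows "char_poly (laplacian_matrix \<Gamma> vs) =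
    [:0, 1:] * [:- (real n - 2), 1:] ^ m * [:- real n, 1:] ^ (n - 1 - m)"
proof -
  define L where "L = laplacian_matrix \<Gamma> vs"
  \<comment> \<open>Vertices are replaced by their positions in \<open>vs\<close>, which index the
    matrix; the bijection \<open>(!) vs\<close> carries the degrees over.\<close>
  define adj where "adj i j \<longleftrightarrow> {vs ! i, vs ! j} \<in> edges \<Gamma>" for i j
  define d where "d i = card {j \<in> {..<n}. adj i j}" for i
  have len: "length vs = n"
    using distinct_card[OF vs(1)] vs(2) n by simp
  have bij: "bij_betw ((!) vs) {..<n} (verts \<Gamma>)"
    using bij_betw_nth[OF vs(1)] len vs(2) by metis
  have inV: "vs ! i \<in> verts \<Gamma>" if "i < n" for i
    using that len vs(2) by (metis nth_mem)
  have adj_sym: "adj j i" if "adj i j" for i j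
    using that by (simp add: adj_def insert_commute)
  have adj_irrefl: "\<not> adj i i" if "i < n" for i
    using loopless[OF inV[OF that]] by (simp add: adj_def)
  have d_vertex: "vertex_degree \<Gamma> (vs ! i) = d i" for i
  proof -
    have "bij_betw ((!) vs) {j \<in> {..<n}. adj i j} {w \<in> verts \<Gamma>. {vs ! i, w} \<in> edges \<Gamma>}"
      using bij by (rule bij_betw_Collect) (simp add: adj_def)
    then show ?thesis
      by (simp add: vertex_degree_def d_def bij_betw_same_card)
  qed
  have d_le: "n \<le> d i + 2" if "i < n" for i
    using deg[OF inV[OF that]] by (simp add: d_vertex)
  have d_less: "d i \<le> n - 1" if "i < n" for i
  proof -
    have "{j \<in> {..<n}. adj i j} \<subseteq> {..<n} - {i}"
      using adj_irrefl[OF that] by auto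
    from card_mono[OF _ this] show ?thesis
      using that by (simp add: d_def)
  qed
  have card_d: "card {i \<in> {..<n}. d i = n - 2} = 2 * m"
  proof -
    have "bij_betw ((!) vs) {i \<in> {..<n}. d i = n - 2} {v \<in> verts \<Gamma>. vertex_degree \<Gamma> v = n - 2}"
      using bij by (rule bij_betw_Collect) (simp add: d_vertex)
    then show ?thesis
      using m by (simp add: bij_betw_same_card)
  qed
  \<comment> \<open>Needed for \<open>f t = t\<close> and \<open>f t = t^2 + t\<close>, the summands
    of the two traces.\<close>
  have sum_d: "(\<Sum>i<n. f (real (d i)))
    = 2 * real m * f (real n - 2) + (real n - 2 * real m) * f (real n - 1)" for f :: "real \<Rightarrow> real"
  proof -
    let ?D = "{i \<in> {..<n}. d i = n - 2}"
    have "(\<Sum>i<n. f (real (d i))) = (\<Sum>i\<in>{..<n} - ?D. f (real (d i))) + (\<Sum>i\<in>?D. f (real (d i)))"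
      by (rule sum.subset_diff) auto
    also have "(\<Sum>i\<in>?D. f (real (d i))) = (\<Sum>i\<in>?D. f (real n - 2))"
      using n by (intro sum.cong) (auto simp: of_nat_diff)
    also have "(\<Sum>i\<in>{..<n} - ?D. f (real (d i))) = (\<Sum>i\<in>{..<n} - ?D. f (real n - 1))"
    proof (rule sum.cong)
      fix i assume "i \<in> {..<n} - ?D"
      then have "d i = n - 1"
        using d_le[of i] d_less[of i] by auto
      then show "f (real (d i)) = f (real n - 1)"
        using n by (simp add: of_nat_diff)
    qed simp
    also have "card ({..<n} - ?D) = n - 2 * m"
      using card_d by (subst card_Diff_subset) auto
    moreover have "2 * m \<le> n"
      using card_mono[of "{..<n}" ?D] card_d by auto
    ultimately show ?thesis
      using card_d by (simp add: of_nat_diff)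
  qed
  have L: "L \<in> carrier_mat n n"
    by (simp add: minus_carrier_mat L_def laplacian_matrix_def degree_matrix_def adjacency_matrix_def len)
  have L_entry: "L $$ (i, j) = (if i = j then real (d i) else 0) - of_bool (adj i j)"
    if "i < n" "j < n" for i j
    using that
    by (simp add: L_def laplacian_matrix_def degree_matrix_def adjacency_matrix_def len
        d_vertex adj_def)
  have tr: "mat_trace L = (\<Sum>i<n. real (d i))"
    using L adj_irrefl by (auto simp: mat_trace_def L_entry intro!: sum.cong)
  \<comment> \<open>By symmetry each term of a diagonal entry of \<open>L * L\<close> is a square:
    \<open>d i\<close> squared from the diagonal, and 1 from each of the \<open>d i\<close>
    neighbours.\<close>
  have tr2: "mat_trace (L * L) = (\<Sum>i<n. (real (d i))\<^sup>2 + real (d i))"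
  proof -
    have "(L * L) $$ (i, i) = (real (d i))\<^sup>2 + real (d i)" if i: "i < n" for i
    proof -
      have "(L * L) $$ (i, i) = (\<Sum>j<n. L $$ (i, j) * L $$ (j, i))"
        using i L by (simp add: scalar_prod_def atLeast0LessThan)
      also have "\<dots> = (\<Sum>j<n. (if i = j then (real (d i))\<^sup>2 else 0) + of_bool (adj i j))"
        using i adj_irrefl[OF i] adj_sym
        by (intro sum.cong) (auto simp: L_entry power2_eq_square)
      also have "\<dots> = (real (d i))\<^sup>2 + real (d i)"
        using i by (simp add: sum.distrib d_def sum.If_cases of_bool_def Int_def)
      finally show ?thesis .
    qed
    then show ?thesis
      using L by (simp add: mat_trace_def)
  qed

  \<comment> \<open>Over the complex numbers the characteristic polynomial splits into linear
    factors, as the trace formulas require. The result returns to the reals because the embedding of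
    polynomials is injective.\<close>
  define LC where "LC = map_mat complex_of_real L"
  have LC: "LC \<in> carrier_mat n n"
    using L by (simp add: LC_def)
  obtain es where es: "char_poly LC = (\<Prod>e\<leftarrow>es. [:- e, 1:])" and len_es: "length es = n"
    using char_poly_factorized[OF LC] by auto
  have "e \<in> {0, of_nat n - 2, of_nat n}" if "e \<in> set es" for e
  proof -
    have "poly (char_poly LC) e = 0"
      unfolding es using that by (auto simp: poly_prod_list prod_list_zero_iff)
    then obtain v where "eigenvector LC v e"
      using eigenvalue_root_char_poly[OF LC] by (auto simp: eigenvalue_def)
    then have v: "v \<in> carrier_vec n" "v \<noteq> 0\<^sub>v n" "LC *\<^sub>v v = e \<cdot>\<^sub>v v"
      using LC by (auto simp: eigenvector_def)
    obtain i\<^sub>0 where i0: "i\<^sub>0 < n" "v $ i\<^sub>0 \<noteq> 0"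
      using v(1-2) by (metis carrier_vecD eq_vecI index_zero_vec)
    have "of_nat (d i) * v $ i - (\<Sum>j\<in>{j \<in> {..<n}. adj i j}. v $ j) = e * v $ i"
      if i: "i < n" for i
    proof -
      have "e * v $ i = (LC *\<^sub>v v) $ i"
        using v i by simp
      also have "\<dots> = (\<Sum>j<n. complex_of_real (L $$ (i, j)) * v $ j)"
        using L v(1) i by (simp add: LC_def scalar_prod_def atLeast0LessThan)
      also have "\<dots> = (\<Sum>j<n. (if i = j then of_nat (d i) * v $ i else 0)
          - (if adj i j then v $ j else 0))"
        using i by (intro sum.cong) (auto simp: L_entry algebra_simps)
      also have "\<dots> = of_nat (d i) * v $ i - (\<Sum>j\<in>{j \<in> {..<n}. adj i j}. v $ j)"
        using i by (simp add: sum_subtractf sum.inter_filter[symmetric])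
      finally show ?thesis ..
    qed
    then show ?thesis
      using near_complete_laplacian_eigenvalue[of "{..<n}" adj "($) v" e i\<^sub>0] i0
        adj_sym adj_irrefl d_le
      by (simp add: d_def)
  qed
  then have es_subset: "set es \<subseteq> {0, of_nat n - 2, of_nat n}"
    by blast
  \<comment> \<open>The bound \<open>n > 2\<close> keeps 0, \<open>n - 2\<close> and
    \<open>n\<close> distinct, so that their multiplicities can be counted separately.\<close>
  have "complex_of_nat n \<noteq> of_nat 2"
    using n by (simp only: of_nat_eq_iff)
  then have distinct: "(0 :: complex) \<noteq> of_nat n - 2" "(0 :: complex) \<noteq> of_nat n"
    "of_nat n - 2 \<noteq> (of_nat n :: complex)"
    using n by auto
  define a b c where "a = count_list es 0" and "b = count_list es (of_nat n - 2)"
    and "c = count_list es (of_nat n)"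
  note count_defs = a_def[symmetric] b_def[symmetric] c_def[symmetric]
  note sums = sum_list_three_values[OF es_subset distinct, unfolded count_defs]
  have "a + b + c = n"
    using sums[of "\<lambda>_. 1 :: nat"] len_es by (simp add: sum_list_triv)
  moreover have "(real n - 2) * real b + real n * real c
      = 2 * real m * (real n - 2) + (real n - 2 * real m) * (real n - 1)"
  proof -
    have "complex_of_real ((real n - 2) * real b + real n * real c) = mat_trace LC"
      using sums[of "\<lambda>e. e"] mat_trace_eigenvalues[OF LC es] by (simp add: mult.commute)
    also have "\<dots> = complex_of_real (mat_trace L)"
      using L by (simp add: mat_trace_def LC_def)
    finally show ?thesis
      using sum_d[of "\<lambda>t. t"] tr by (simp only: of_real_eq_iff)
  qed
  moreover have "(real n - 2)\<^sup>2 * real b + (real n)\<^sup>2 * real c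
      = 2 * real m * ((real n - 2)\<^sup>2 + (real n - 2))
        + (real n - 2 * real m) * ((real n - 1)\<^sup>2 + (real n - 1))"
  proof -
    have "complex_of_real ((real n - 2)\<^sup>2 * real b + (real n)\<^sup>2 * real c) = mat_trace (LC * LC)"
      using sums[of "\<lambda>e. e\<^sup>2"] mat_trace_square_eigenvalues[OF LC es] by (simp add: mult.commute)
    also have "LC * LC = map_mat complex_of_real (L * L)"
      unfolding LC_def by (rule of_real_hom.mat_hom_mult[OF L L, symmetric])
    also have "mat_trace \<dots> = complex_of_real (mat_trace (L * L))"
      using L by (simp add: mat_trace_def)
    finally show ?thesis
      using sum_d[of "\<lambda>t. t\<^sup>2 + t"] tr2 by (simp only: of_real_eq_iff)
  qed
  ultimately have abc: "a = 1" "b = m" "c = n - 1 - m"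
    using near_complete_multiplicities[OF n(2)] by blast+
  interpret map_poly_hom: map_poly_inj_idom_hom complex_of_real ..
  have "map_poly complex_of_real (char_poly L) = char_poly LC"
    unfolding LC_def by (rule of_real_hom.char_poly_hom[OF L, symmetric])
  also have "\<dots> = [:0, 1:] * [:- (of_nat n - 2), 1:] ^ m * [:- of_nat n, 1:] ^ (n - 1 - m)"
    unfolding es prod_list_three_values[OF es_subset distinct, unfolded count_defs] abc by simp
  also have "\<dots> = map_poly complex_of_real
      ([:0, 1:] * [:- (real n - 2), 1:] ^ m * [:- real n, 1:] ^ (n - 1 - m))"
    by (simp add: map_poly_hom.hom_mult map_poly_hom.hom_power)
  finally show ?thesis
    unfolding L_def by (rule map_poly_hom.injectivity)
qed

section \<open>Degrees under isomorphism and under added edges\<close>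

lemma vertex_degree_isomorphic:
  assumes f: "bij_betw f (verts \<Gamma>) (verts \<Gamma>')"
    and edges: "\<And>u v. u \<in> verts \<Gamma> \<Longrightarrow> v \<in> verts \<Gamma> \<Longrightarrow> {u, v} \<in> edges \<Gamma> \<longleftrightarrow> {f u, f v} \<in> edges \<Gamma>'"
    and u: "u \<in> verts \<Gamma>"
  shows "vertex_degree \<Gamma>' (f u) = vertex_degree \<Gamma> u"
proof -
  have "bij_betw f {w \<in> verts \<Gamma>. {u, w} \<in> edges \<Gamma>} {w \<in> verts \<Gamma>'. {f u, w} \<in> edges \<Gamma>'}"
    using f by (rule bij_betw_Collect) (simp add: edges[OF u])
  then show ?thesis
    by (simp add: vertex_degree_def bij_betw_same_card)
qed

text \<open>In a loopless \<open>(n - 2)\<close>-regular graph on \<open>n\<close> vertices each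
  vertex has exactly one non-neighbour other than itself. The non-edges thus form a perfect
  matching, and any subset \<open>N\<close> of them is a matching.\<close>

lemma
  fixes \<Gamma> :: "'v graph"
  assumes n: "card (verts \<Gamma>) = n" "n \<ge> 2" and reg: "regular_graph (n - 2) \<Gamma>"
    and loopless: "\<And>v. v \<in> verts \<Gamma> \<Longrightarrow> {v} \<notin> edges \<Gamma>" and N: "N \<subseteq> non_edges \<Gamma>"
  shows vertex_degree_add_edges_matching: "v \<in> verts \<Gamma> \<Longrightarrow>
      vertex_degree (add_edges \<Gamma> N) v = (if v \<in> \<Union>N then n - 1 else n - 2)"
    and card_Union_matching: "card (\<Union>N) = 2 * card N"
proof -
  have fin: "finite (verts \<Gamma>)"
    using n by (metis card.infinite not_numeral_le_zero)
  define C where "C v = {w \<in> verts \<Gamma>. w \<noteq> v \<and> {v, w} \<notin> edges \<Gamma>}" for v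
  have C: "card (C v) = 1" if v: "v \<in> verts \<Gamma>" for v
  proof -
    let ?A = "{w \<in> verts \<Gamma>. {v, w} \<in> edges \<Gamma>}"
    have "C v = verts \<Gamma> - insert v ?A"
      by (auto simp: C_def)
    moreover have "card (insert v ?A) = n - 1"
      using reg v fin loopless[OF v] n by (auto simp: regular_graph_def vertex_degree_def)
    moreover have "insert v ?A \<subseteq> verts \<Gamma>"
      using v by auto
    ultimately show ?thesis
      using fin n by (simp add: card_Diff_subset finite_subset[of "insert v ?A"])
  qed
  have N_C: "w \<in> C v" if "{v, w} \<in> N" for v w
    using that N by (auto simp: non_edges_def C_def doubleton_eq_iff insert_commute)
  \<comment> \<open>Any endpoint of an edge of \<open>N\<close> may be written first.\<close>
  have N_ends: "\<exists>w. e = {v, w} \<and> v \<in> verts \<Gamma> \<and> w \<in> C v" if e: "e \<in> N" "v \<in> e" for e v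
  proof -
    obtain s t where "e = {s, t}" "s \<in> verts \<Gamma>" "t \<in> verts \<Gamma>"
      using e N unfolding non_edges_def by blast
    then show ?thesis
      using e N_C[of s t] N_C[of t s] by (auto simp: insert_commute)
  qed
  show "vertex_degree (add_edges \<Gamma> N) v = (if v \<in> \<Union>N then n - 1 else n - 2)"
    if v: "v \<in> verts \<Gamma>"
  proof (cases "v \<in> \<Union>N")
    case True
    then obtain w where w: "{v, w} \<in> N" "w \<in> C v"
      using N_ends by blast
    \<comment> \<open>The added edge at \<open>v\<close> supplies its only missing neighbour, so
      \<open>v\<close> becomes adjacent to all other vertices.\<close>
    with C[OF v] have Cv: "C v = {w}"
      by (auto simp: card_1_singleton_iff)
    have "{v, v} \<notin> edges \<Gamma> \<union> N"
      using N_C[of v v] loopless[OF v] by (simp add: C_def) blast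
    moreover have "{v, u} \<in> edges \<Gamma> \<union> N" if "u \<in> verts \<Gamma>" "u \<noteq> v" for u
    proof (cases "u = w")
      case False
      then have "u \<notin> C v"
        by (simp add: Cv)
      with that show ?thesis
        by (simp add: C_def)
    qed (use w in simp)
    ultimately have "{u \<in> verts \<Gamma>. {v, u} \<in> edges \<Gamma> \<union> N} = verts \<Gamma> - {v}"
      by blast
    then show ?thesis
      using True v n fin by (simp add: vertex_degree_def add_edges_def)
  next
    case False
    then have "{u \<in> verts \<Gamma>. {v, u} \<in> edges \<Gamma> \<union> N} = {u \<in> verts \<Gamma>. {v, u} \<in> edges \<Gamma>}"
      by auto
    then show ?thesis
      using False v reg by (simp add: regular_graph_def vertex_degree_def add_edges_def)
  qed
  \<comment> \<open>Two edges of \<open>N\<close> sharing \<open>v\<close> both have their other end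
    in the singleton \<open>C v\<close>, so they coincide.\<close>
  have "disjoint N"
  proof (rule disjointI)
    fix e e' assume e: "e \<in> N" "e' \<in> N" "e \<noteq> e'"
    show "e \<inter> e' = {}"
    proof (rule ccontr)
      assume "e \<inter> e' \<noteq> {}"
      then obtain v where "v \<in> e" "v \<in> e'"
        by blast
      then obtain w w' where "e = {v, w}" "e' = {v, w'}" "v \<in> verts \<Gamma>" "w \<in> C v" "w' \<in> C v"
        using N_ends e by metis
      with C e show False
        by (metis card_1_singletonE singletonD)
    qed
  qed
  moreover have "card e = 2" if "e \<in> N" for e
    using that N by (auto simp: non_edges_def)
  ultimately show "card (\<Union>N) = 2 * card N"
    by (subst card_Union_disjoint) (auto simp: card_ge_0_finite)
qed

theorem theorem3p7:
  fixes G :: "('a, 'm) monoid_scheme" and G1 :: "('b, 'k) monoid_scheme"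
    and n n1 :: nat and N :: "nat set set" and vs :: "nat list"
  assumes "n \<ge> 4" and "even n"
    and "group G" and "finite (carrier G)" and "solvable G"
    and "card (verts (character_degree_graph G)) = n"
    and "regular_graph (n - 2) (character_degree_graph G)"
    and "1 \<le> n1" and "n1 \<le> n div 2"
    and "group G1" and "finite (carrier G1)" and "solvable G1"
    and "N \<subseteq> non_edges (character_degree_graph G)" and "card N = n1"
    and "graph_isomorphic (character_degree_graph G1) (add_edges (character_degree_graph G) N)"
    and "distinct vs" and "set vs = verts (character_degree_graph G1)"
  shows "char_poly (laplacian_matrix (character_degree_graph G1) vs) =
    [:0, 1:] * [:- (real n - 2), 1:] ^ (n div 2 - n1) * [:- real n, 1:] ^ (n div 2 + n1 - 1)"
proof -
  let ?\<Gamma> = "character_degree_graph G" and ?\<Gamma>\<^sub>1 = "character_degree_graph G1"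
  let ?\<Gamma>' = "add_edges ?\<Gamma> N"
  \<comment> \<open>Stated for an arbitrary group type because it is applied to both
    \<open>G\<close> and \<open>G1\<close>.\<close>
  have loopless: "{v} \<notin> edges (character_degree_graph H)"
    for v and H :: "('c, 'l) monoid_scheme"
    by (auto simp: character_degree_graph_def doubleton_eq_iff)
  have fin: "finite (verts ?\<Gamma>)"
    using assms(1,6) by (metis card.infinite not_numeral_le_zero)
  have verts': "verts ?\<Gamma>' = verts ?\<Gamma>"
    by (simp add: add_edges_def)
  obtain f where f: "bij_betw f (verts ?\<Gamma>\<^sub>1) (verts ?\<Gamma>')"
    and f_edges: "\<And>u v. u \<in> verts ?\<Gamma>\<^sub>1 \<Longrightarrow> v \<in> verts ?\<Gamma>\<^sub>1 \<Longrightarrow>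
      {u, v} \<in> edges ?\<Gamma>\<^sub>1 \<longleftrightarrow> {f u, f v} \<in> edges ?\<Gamma>'"
    using assms(15) unfolding graph_isomorphic_def by blast
  have n2: "2 \<le> n"
    using assms(1) by simp
  note deg' = vertex_degree_add_edges_matching[OF assms(6) n2 assms(7) loopless assms(13)]
  have deg: "vertex_degree ?\<Gamma>\<^sub>1 u = (if f u \<in> \<Union>N then n - 1 else n - 2)" if "u \<in> verts ?\<Gamma>\<^sub>1" for u
    using vertex_degree_isomorphic[OF f f_edges that] deg' f that
    by (metis bij_betwE verts')
  \<comment> \<open>The vertices of degree \<open>n - 2\<close> correspond to those that no new edge
    meets; \<open>n \<ge> 4\<close> keeps \<open>n - 1\<close> and \<open>n - 2\<close>
    apart.\<close>
  have "bij_betw f {u \<in> verts ?\<Gamma>\<^sub>1. vertex_degree ?\<Gamma>\<^sub>1 u = n - 2} {v \<in> verts ?\<Gamma>'. v \<notin> \<Union>N}"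
    using f by (rule bij_betw_Collect) (use deg assms(1) in auto)
  then have "bij_betw f {u \<in> verts ?\<Gamma>\<^sub>1. vertex_degree ?\<Gamma>\<^sub>1 u = n - 2} (verts ?\<Gamma> - \<Union>N)"
    by (simp add: verts' set_diff_eq)
  \<comment> \<open>Evenness of \<open>n\<close> turns \<open>n - 2 * n1\<close> into this form,
    which identifies \<open>m\<close> as \<open>n div 2 - n1\<close>.\<close>
  moreover have "card (verts ?\<Gamma> - \<Union>N) = 2 * (n div 2 - n1)"
  proof -
    have "\<Union>N \<subseteq> verts ?\<Gamma>"
      using assms(13) by (auto simp: non_edges_def)
    then have "card (verts ?\<Gamma> - \<Union>N) = n - 2 * n1"
      using card_Union_matching[OF assms(6) n2 assms(7) loopless assms(13)] fin assms(6,14)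
      by (simp add: card_Diff_subset finite_subset)
    then show ?thesis
      using assms(2) by auto
  qed
  ultimately have "card {u \<in> verts ?\<Gamma>\<^sub>1. vertex_degree ?\<Gamma>\<^sub>1 u = n - 2} = 2 * (n div 2 - n1)"
    by (simp add: bij_betw_same_card)
  moreover have "card (verts ?\<Gamma>\<^sub>1) = n"
    using bij_betw_same_card[OF f] assms(6) verts' by simp
  moreover have "n - 2 \<le> vertex_degree ?\<Gamma>\<^sub>1 u" if "u \<in> verts ?\<Gamma>\<^sub>1" for u
    using deg[OF that] by (simp add: diff_le_mono2)
  ultimately have "char_poly (laplacian_matrix ?\<Gamma>\<^sub>1 vs) = [:0, 1:] * [:- (real n - 2), 1:] ^ (n div 2 - n1)
      * [:- real n, 1:] ^ (n - 1 - (n div 2 - n1))"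
    using assms(1) loopless
    by (intro char_poly_laplacian_near_complete[OF assms(16-17)]) auto
  \<comment> \<open>The bound on \<open>n1\<close> prevents truncation of the inner subtraction, and
    \<open>n\<close> is twice \<open>n div 2\<close>.\<close>
  moreover have "n - 1 - (n div 2 - n1) = n div 2 + n1 - 1"
    using assms(2,9) by auto
  ultimately show ?thesis
    by simp
qed

end
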